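(* Let $G$ be a finitely generated group, let $H\leq G$ be a subgroup of finite index, and suppose that $G$ is the disjoint union $G=\bigcup_{i=1}^n Hb_i$ with $b_1,\ldots,b_n\in G$. Then $\mathrm{Alg}(G)$ consists of exactly all subsets of the form $$\bigcup_{i=1}^{n} L_ib_i,\qquad L_i\in \mathrm{Alg}(H)\ (i=1,\ldots,n).$$
   Context: For a finitely generated group $G$ with finite generating set $A$, let $\tilde A=A\cup A^{-1}$ (formal inverses) and let $\pi:\tilde A^*\to G$ be the canonical surjective monoid homomorphism. A subset $K\subseteq G$ is called algebraic if there is a context-free language $L\subseteq\tilde A^*$ with $L\pi=K$; $\mathrm{Alg}(G)$ denotes the class of algebraic subsets of $G$. (This class does not depend on the choice of finite generating set.) *)

theory Defs
  imports "HOL-Algebra.Generated_Groups" "HOL-Library.Disjoint_Sets"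
begin

section \<open>Context-free languages\<close>

text \<open>In a sentential form, \<open>Inl\<close> marks nonterminals and \<open>Inr\<close> marks terminals.\<close>

type_synonym ('n, 't) production = "'n \<times> ('n + 't) list"

inductive derives1 ::
  "('n, 't) production set \<Rightarrow> ('n + 't) list \<Rightarrow> ('n + 't) list \<Rightarrow> bool"
  for P where
  "(N, w) \<in> P \<Longrightarrow> derives1 P (u @ [Inl N] @ v) (u @ w @ v)"

definition grammar_lang :: "('n, 't) production set \<Rightarrow> 'n \<Rightarrow> 't list set" where
  "grammar_lang P S = {w. (derives1 P)\<^sup>*\<^sup>* [Inl S] (map Inr w)}"

text \<open>Only finitely many nonterminals occur in a finite set of productions, so it is no
  restriction to take them from the type \<open>nat\<close>.\<close>

definition context_free :: "'t list set \<Rightarrow> bool" where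
  "context_free L \<longleftrightarrow>
     (\<exists>(P :: (nat, 't) production set) S. finite P \<and> L = grammar_lang P S)"


section \<open>Algebraic subsets of a group\<close>

text \<open>The letters are formal: \<open>Neg a\<close> differs from every \<open>Pos b\<close>, even if the inverse of
  \<open>a\<close> happens to be a generator as well.\<close>

datatype 'a letter = Pos 'a | Neg 'a

definition letters :: "'a set \<Rightarrow> 'a letter set" where
  "letters A = Pos ` A \<union> Neg ` A"

fun letter_val :: "('a, 'b) monoid_scheme \<Rightarrow> 'a letter \<Rightarrow> 'a" where
  "letter_val G (Pos a) = a"
| "letter_val G (Neg a) = inv\<^bsub>G\<^esub> a"

definition word_val :: "('a, 'b) monoid_scheme \<Rightarrow> 'a letter list \<Rightarrow> 'a" where
  "word_val G w = foldr (\<lambda>x g. letter_val G x \<otimes>\<^bsub>G\<^esub> g) w \<one>\<^bsub>G\<^esub>"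

definition finite_generating_set :: "('a, 'b) monoid_scheme \<Rightarrow> 'a set \<Rightarrow> bool" where
  "finite_generating_set G A \<longleftrightarrow> finite A \<and> A \<subseteq> carrier G \<and> generate G A = carrier G"

definition finitely_generated :: "('a, 'b) monoid_scheme \<Rightarrow> bool" where
  "finitely_generated G \<longleftrightarrow> (\<exists>A. finite_generating_set G A)"

definition algebraic_wrt :: "('a, 'b) monoid_scheme \<Rightarrow> 'a set \<Rightarrow> 'a set \<Rightarrow> bool" where
  "algebraic_wrt G A K \<longleftrightarrow>
     (\<exists>L. context_free L \<and> L \<subseteq> lists (letters A) \<and> word_val G ` L = K)"

text \<open>The class does not depend on the generating set; see \<open>Alg_iff_algebraic_wrt\<close> below.
  It is empty if \<open>G\<close> is not finitely generated.\<close>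

definition Alg :: "('a, 'b) monoid_scheme \<Rightarrow> 'a set set" where
  "Alg G = {K. \<exists>A. finite_generating_set G A \<and> algebraic_wrt G A K}"


section \<open>Independence of the generating set\<close>

definition subst_form :: "('t \<Rightarrow> 's list) \<Rightarrow> ('n + 't) list \<Rightarrow> ('n + 's) list" where
  "subst_form \<sigma> u = concat (map (case_sum (\<lambda>N. [Inl N]) (\<lambda>t. map Inr (\<sigma> t))) u)"

lemma subst_form_simps [simp]:
  "subst_form \<sigma> [] = []"
  "subst_form \<sigma> (Inl N # u) = Inl N # subst_form \<sigma> u"
  "subst_form \<sigma> (Inr t # u) = map Inr (\<sigma> t) @ subst_form \<sigma> u"
  "subst_form \<sigma> (u @ v) = subst_form \<sigma> u @ subst_form \<sigma> v"
  by (simp_all add: subst_form_def)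

lemma subst_form_Inr [simp]:
  "subst_form \<sigma> (map Inr w) = map Inr (concat (map \<sigma> w))"
  by (induction w) auto

lemma subst_form_split:
  assumes "subst_form \<sigma> u = x @ Inl N # y"
  shows "\<exists>x' y'. u = x' @ Inl N # y' \<and> x = subst_form \<sigma> x' \<and> y = subst_form \<sigma> y'"
  using assms
proof (induction u arbitrary: x)
  case Nil
  then show ?case by simp
next
  case (Cons s u)
  show ?case
  proof (cases s)
    case (Inl M)
    show ?thesis
    proof (cases x)
      case Nil
      then have "s # u = [] @ Inl N # u \<and> x = subst_form \<sigma> [] \<and> y = subst_form \<sigma> u"
        using Cons.prems Inl by auto
      then show ?thesis by blast
    next
      case (Cons c x1)
      then have "subst_form \<sigma> u = x1 @ Inl N # y" and c: "c = Inl M"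
        using Cons.prems Inl by auto
      from Cons.IH[OF this(1)] obtain x' y'
        where "u = x' @ Inl N # y'" "x1 = subst_form \<sigma> x'" "y = subst_form \<sigma> y'"
        by blast
      then have "s # u = (s # x') @ Inl N # y' \<and> x = subst_form \<sigma> (s # x') \<and> y = subst_form \<sigma> y'"
        using Inl Cons c by simp
      then show ?thesis by blast
    qed
  next
    case (Inr t)
    have eq: "map Inr (\<sigma> t) @ subst_form \<sigma> u = x @ Inl N # y"
      using Cons.prems Inr by simp
    then obtain zs where
      "map Inr (\<sigma> t) = x @ zs \<and> zs @ subst_form \<sigma> u = Inl N # y
       \<or> map Inr (\<sigma> t) @ zs = x \<and> subst_form \<sigma> u = zs @ Inl N # y"
      by (auto simp: append_eq_append_conv2)
    then show ?thesis
    proof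
      assume a: "map Inr (\<sigma> t) = x @ zs \<and> zs @ subst_form \<sigma> u = Inl N # y"
      show ?thesis
      proof (cases zs)
        case Nil
        with a have "subst_form \<sigma> u = [] @ Inl N # y" "x = map Inr (\<sigma> t)" by auto
        from Cons.IH[OF this(1)] obtain x' y'
          where "u = x' @ Inl N # y'" "[] = subst_form \<sigma> x'" "y = subst_form \<sigma> y'"
          by blast
        with \<open>x = _\<close> have "s # u = (s # x') @ Inl N # y' \<and> x = subst_form \<sigma> (s # x')
            \<and> y = subst_form \<sigma> y'" using Inr by simp
        then show ?thesis by blast
      next
        case (Cons z zs')
        with a have "map Inr (\<sigma> t) = x @ Inl N # zs'" by simp
        then have "Inl N \<in> Inr ` set (\<sigma> t)"
          by (metis in_set_conv_decomp list.set_map)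
        then show ?thesis by auto
      qed
    next
      assume a: "map Inr (\<sigma> t) @ zs = x \<and> subst_form \<sigma> u = zs @ Inl N # y"
      from Cons.IH[OF conjunct2[OF a]] obtain x' y'
        where "u = x' @ Inl N # y'" "zs = subst_form \<sigma> x'" "y = subst_form \<sigma> y'"
        by blast
      with a have "s # u = (s # x') @ Inl N # y' \<and> x = subst_form \<sigma> (s # x')
          \<and> y = subst_form \<sigma> y'" using Inr by auto
      then show ?thesis by blast
    qed
  qed
qed

lemma subst_form_eq_Inr:
  assumes "subst_form \<sigma> u = map Inr w"
  shows "\<exists>w'. u = map Inr w' \<and> w = concat (map \<sigma> w')"
proof -
  have "Inl N \<notin> set u" for N
  proof
    assume "Inl N \<in> set u"
    then have "Inl N \<in> set (subst_form \<sigma> u)"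
      by (force simp: subst_form_def)
    then show False using assms by auto
  qed
  then have "\<forall>s\<in>set u. s \<in> range Inr"
    by (metis rangeI sum.exhaust)
  then have "u \<in> lists (range Inr)" by auto
  then obtain w' where "u = map Inr w'"
    by (metis (no_types, lifting) ex_map_conv in_listsD rangeE)
  moreover from this assms have "w = concat (map \<sigma> w')"
    by (simp add: inj_map_eq_map)
  ultimately show ?thesis by blast
qed

lemma context_free_subst:
  assumes "context_free L"
  shows "context_free ((\<lambda>w. concat (map \<sigma> w)) ` L)"
proof -
  from assms obtain P :: "(nat, 'a) production set" and S
    where P: "finite P" "L = grammar_lang P S"
    by (auto simp: context_free_def)
  define Q where "Q = (\<lambda>(N, w). (N, subst_form \<sigma> w)) ` P"
  have fwd1: "derives1 Q (subst_form \<sigma> u) (subst_form \<sigma> v)" if "derives1 P u v" for u v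
    using that
  proof cases
    case (1 N w x y)
    then have "(N, subst_form \<sigma> w) \<in> Q" by (force simp: Q_def)
    from derives1.intros[OF this] show ?thesis using 1 by simp
  qed
  have fwd: "(derives1 Q)\<^sup>*\<^sup>* (subst_form \<sigma> u) (subst_form \<sigma> v)" if "(derives1 P)\<^sup>*\<^sup>* u v" for u v
    using that by induction (auto intro: fwd1 rtranclp.rtrancl_into_rtrancl)
  have bwd1: "\<exists>v. v' = subst_form \<sigma> v \<and> derives1 P u v" if "derives1 Q (subst_form \<sigma> u) v'" for u v'
    using that
  proof cases
    case (1 N w x y)
    from 1(1) obtain x' y' where xy: "u = x' @ Inl N # y'"
        "x = subst_form \<sigma> x'" "y = subst_form \<sigma> y'"
      using subst_form_split[of \<sigma> u x N y] by auto
    from 1(3) obtain w' where w': "(N, w') \<in> P" "w = subst_form \<sigma> w'" by (auto simp: Q_def)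
    have "derives1 P u (x' @ w' @ y')"
      using derives1.intros[OF w'(1), of x' y'] xy by simp
    then show ?thesis using xy w' 1(2) by (intro exI[of _ "x' @ w' @ y'"]) simp
  qed
  have bwd: "\<exists>v. v' = subst_form \<sigma> v \<and> (derives1 P)\<^sup>*\<^sup>* u v"
    if "(derives1 Q)\<^sup>*\<^sup>* (subst_form \<sigma> u) v'" for u v'
    using that
  proof induction
    case base
    then show ?case by blast
  next
    case (step y z)
    then show ?case by (metis bwd1 rtranclp.rtrancl_into_rtrancl)
  qed
  have "grammar_lang Q S = (\<lambda>w. concat (map \<sigma> w)) ` L"
  proof (intro equalityI subsetI)
    fix w assume "w \<in> grammar_lang Q S"
    then have "(derives1 Q)\<^sup>*\<^sup>* (subst_form \<sigma> [Inl S]) (map Inr w)"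
      by (simp add: grammar_lang_def)
    from bwd[OF this] obtain v where v: "map Inr w = subst_form \<sigma> v" "(derives1 P)\<^sup>*\<^sup>* [Inl S] v"
      by blast
    obtain w' where "v = map Inr w'" "w = concat (map \<sigma> w')"
      using subst_form_eq_Inr[OF v(1)[symmetric]] by blast
    with v(2) show "w \<in> (\<lambda>w. concat (map \<sigma> w)) ` L"
      unfolding P(2) grammar_lang_def by blast
  next
    fix w assume "w \<in> (\<lambda>w. concat (map \<sigma> w)) ` L"
    then obtain w' where w': "w = concat (map \<sigma> w')" "(derives1 P)\<^sup>*\<^sup>* [Inl S] (map Inr w')"
      unfolding P(2) grammar_lang_def by blast
    from fwd[OF w'(2)] show "w \<in> grammar_lang Q S"
      by (simp add: grammar_lang_def w'(1))
  qed
  moreover have "finite Q" using P(1) by (simp add: Q_def)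
  ultimately show ?thesis unfolding context_free_def by metis
qed

context group
begin

lemma letter_val_closed:
  "A \<subseteq> carrier G \<Longrightarrow> x \<in> letters A \<Longrightarrow> letter_val G x \<in> carrier G"
  by (auto simp: letters_def)

lemma word_val_simps [simp]:
  "word_val G [] = \<one>"
  "word_val G (x # w) = letter_val G x \<otimes> word_val G w"
  by (simp_all add: word_val_def)

lemma word_val_closed:
  "A \<subseteq> carrier G \<Longrightarrow> w \<in> lists (letters A) \<Longrightarrow> word_val G w \<in> carrier G"
  by (induction w) (auto intro: letter_val_closed)

lemma word_val_append:
  assumes "A \<subseteq> carrier G" "u \<in> lists (letters A)" "v \<in> lists (letters A)"
  shows "word_val G (u @ v) = word_val G u \<otimes> word_val G v"
  using assms(2)
proof (induction u)
  case Nil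
  then show ?case using assms by (simp add: word_val_closed)
next
  case (Cons x u)
  then show ?case using assms
    by (simp add: m_assoc letter_val_closed[OF assms(1)] word_val_closed[OF assms(1)])
qed

lemma generate_imp_word_val:
  assumes "A \<subseteq> carrier G" "g \<in> generate G A"
  shows "\<exists>w \<in> lists (letters A). word_val G w = g"
  using assms(2)
proof induction
  case one
  show ?case by (intro bexI[of _ "[]"]) auto
next
  case (incl h)
  then show ?case using assms(1) by (intro bexI[of _ "[Pos h]"]) (auto simp: letters_def)
next
  case (inv h)
  then show ?case using assms(1) by (intro bexI[of _ "[Neg h]"]) (auto simp: letters_def)
next
  case (eng h1 h2)
  then obtain w1 w2 where "w1 \<in> lists (letters A)" "word_val G w1 = h1"
      "w2 \<in> lists (letters A)" "word_val G w2 = h2" by blast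
  then show ?case using assms(1)
    by (intro bexI[of _ "w1 @ w2"]) (auto simp: word_val_append)
qed

lemma algebraic_wrt_change:
  assumes A: "finite_generating_set G A" and B: "finite_generating_set G B"
    and K: "algebraic_wrt G A K"
  shows "algebraic_wrt G B K"
proof -
  have AG: "A \<subseteq> carrier G" and BG: "B \<subseteq> carrier G" and gB: "generate G B = carrier G"
    using A B by (auto simp: finite_generating_set_def)
  have "\<forall>x\<in>letters A. \<exists>w. w \<in> lists (letters B) \<and> word_val G w = letter_val G x"
    using generate_imp_word_val[OF BG] gB letter_val_closed[OF AG] by blast
  then obtain \<sigma> where \<sigma>: "\<And>x. x \<in> letters A \<Longrightarrow> \<sigma> x \<in> lists (letters B)"
      "\<And>x. x \<in> letters A \<Longrightarrow> word_val G (\<sigma> x) = letter_val G x"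
    by metis
  have cl: "concat (map \<sigma> w) \<in> lists (letters B)" if "w \<in> lists (letters A)" for w
    using that by (induction w) (use \<sigma>(1) in auto)
  have val: "word_val G (concat (map \<sigma> w)) = word_val G w" if "w \<in> lists (letters A)" for w
    using that
  proof (induction w)
    case Nil
    then show ?case by simp
  next
    case (Cons x w)
    then show ?case using word_val_append[OF BG \<sigma>(1) cl] \<sigma>(2) by simp
  qed
  from K obtain L where L: "context_free L" "L \<subseteq> lists (letters A)" "word_val G ` L = K"
    by (auto simp: algebraic_wrt_def)
  let ?L' = "(\<lambda>w. concat (map \<sigma> w)) ` L"
  have "?L' \<subseteq> lists (letters B)" using cl L(2) by blast
  moreover have "word_val G ` ?L' = K"
  proof -
    have "word_val G ` ?L' = (\<lambda>w. word_val G (concat (map \<sigma> w))) ` L"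
      by (simp add: image_image)
    also have "\<dots> = word_val G ` L" using val L(2) by (intro image_cong) auto
    finally show ?thesis using L(3) by simp
  qed
  ultimately show ?thesis
    using context_free_subst[OF L(1)] unfolding algebraic_wrt_def by blast
qed

theorem Alg_iff_algebraic_wrt:
  assumes "finite_generating_set G A"
  shows "K \<in> Alg G \<longleftrightarrow> algebraic_wrt G A K"
  using assms algebraic_wrt_change by (auto simp: Alg_def)

end

end

theory Submission
  imports Defs "HOL-Library.Countable"
begin

text \<open>Reading a word \<open>w\<close> over the generators of \<open>G\<close> while recording the coset \<open>H b\<^sub>p\<close> reached,
  a letter \<open>x\<close> leading from \<open>p\<close> to \<open>q\<close> can be rewritten as the Schreier generator
  \<open>b\<^sub>p x b\<^sub>q\<^sup>-\<^sup>1 \<in> H\<close>; the product telescopes to \<open>b\<^sub>p w b\<^sub>q\<^sup>-\<^sup>1\<close>. Hence \<open>H\<close> is finitely generated. The rewriting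
  is done by a finite letter-to-letter transducer, and such transducers preserve context-freeness,
  so the part of an algebraic set lying in \<open>H b\<^sub>i\<close> is \<open>L\<^sub>i b\<^sub>i\<close> with \<open>L\<^sub>i\<close> algebraic in \<open>H\<close>. Conversely,
  \<open>\<Union>\<^sub>i L\<^sub>i b\<^sub>i\<close> is the value of a finite union of context-free languages with a letter
  appended.\<close>

section \<open>Closure properties of context-free languages\<close>

text \<open>Big-step form of derivation: a sentential form is read from left to right, and each
  nonterminal carries the parse tree of its own expansion. Inductions on \<open>yields\<close>
  follow the structure of the form, which sequences of \<open>derives1\<close> steps do not.\<close>

inductive yields :: "('n, 't) production set \<Rightarrow> ('n + 't) list \<Rightarrow> 't list \<Rightarrow> bool"
  for P where
  Nil: "yields P [] []"
| Term: "yields P u w \<Longrightarrow> yields P (Inr t # u) (t # w)"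
| Nonterm: "(N, v) \<in> P \<Longrightarrow> yields P v w1 \<Longrightarrow> yields P u w2 \<Longrightarrow> yields P (Inl N # u) (w1 @ w2)"

inductive_simps yields_Nil [simp]: "yields P [] w"
inductive_simps yields_Inr: "yields P (Inr t # u) w"
inductive_simps yields_Inl: "yields P (Inl N # u) w"

lemma yields_map_Inr: "yields P (map Inr w) w' \<longleftrightarrow> w' = w"
  by (induction w arbitrary: w') (auto simp: yields_Inr)

lemma yields_append:
  "yields P (u @ v) w \<longleftrightarrow> (\<exists>w1 w2. w = w1 @ w2 \<and> yields P u w1 \<and> yields P v w2)"
proof (induction u arbitrary: w)
  case (Cons s u)
  show ?case
  proof (cases s)
    case (Inl N)
    have "yields P ((s # u) @ v) w \<longleftrightarrow>
        (\<exists>x w1 w2 w3. (N, x) \<in> P \<and> yields P x w1 \<and> yields P u w2 \<and> yields P v w3 \<and> w = (w1 @ w2) @ w3)"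
      using Inl by (auto simp: yields_Inl Cons.IH) blast
    also have "\<dots> \<longleftrightarrow> (\<exists>w1 w2. w = w1 @ w2 \<and> yields P (s # u) w1 \<and> yields P v w2)"
      unfolding Inl yields_Inl by (intro iffI; elim exE conjE; hypsubst; blast)
    finally show ?thesis .
  next
    case (Inr t)
    then show ?thesis by (auto simp: yields_Inr Cons.IH Cons_eq_append_conv) blast+
  qed
qed simp

lemma derives_context:
  assumes "(derives1 P)\<^sup>*\<^sup>* u v"
  shows "(derives1 P)\<^sup>*\<^sup>* (x @ u @ y) (x @ v @ y)"
  using assms
proof induction
  case (step v w)
  from step.hyps(2) have "derives1 P (x @ v @ y) (x @ w @ y)"
  proof cases
    case (1 N z a b)
    then show ?thesis using derives1.intros[of N z P "x @ a" "b @ y"] by simp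
  qed
  with step.IH show ?case by (rule rtranclp.rtrancl_into_rtrancl)
qed simp

text \<open>From left to right, the tree of the leading nonterminal is unfolded first and the rest
  of the form afterwards, each in its context. Conversely, going backwards from the terminal word, a
  rewriting step regroups the part of the word produced by a right-hand side under the nonterminal
  that it replaced.\<close>

lemma yields_iff_derives: "yields P u w \<longleftrightarrow> (derives1 P)\<^sup>*\<^sup>* u (map Inr w)"
proof
  show "(derives1 P)\<^sup>*\<^sup>* u (map Inr w)" if "yields P u w"
    using that
  proof induction
    case (Term u w t)
    then show ?case using derives_context[of P u "map Inr w" "[Inr t]" "[]"] by simp
  next
    case (Nonterm N v w1 u w2)
    have "derives1 P (Inl N # u) (v @ u)"
      using derives1.intros[OF Nonterm.hyps(1), of "[]" u] by simp
    also have "(derives1 P)\<^sup>*\<^sup>* (v @ u) (map Inr w1 @ u)"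
      using derives_context[OF Nonterm.IH(1), of "[]" u] by simp
    also have "(derives1 P)\<^sup>*\<^sup>* (map Inr w1 @ u) (map Inr w1 @ map Inr w2)"
      using derives_context[OF Nonterm.IH(2), of "map Inr w1" "[]"] by simp
    finally show ?case by simp
  qed simp
  show "yields P u w" if "(derives1 P)\<^sup>*\<^sup>* u (map Inr w)"
    using that
  proof (induction rule: converse_rtranclp_induct)
    case base
    show ?case by (simp add: yields_map_Inr)
  next
    case (step u v)
    from step.hyps(1) step.IH show ?case
    proof cases
      case (1 N z x y)
      then have "yields P (x @ z @ y) w" using step.IH by simp
      then obtain w1 w2 w3 where w: "w = w1 @ w2 @ w3" "yields P x w1" "yields P z w2" "yields P y w3"
        by (auto simp: yields_append)
      moreover have "yields P (Inl N # y) (w2 @ w3)"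
        using 1 w by (auto intro: yields.Nonterm)
      ultimately show ?thesis using 1 by (auto simp: yields_append)
    qed
  qed
qed

lemma grammar_lang_yields: "grammar_lang P S = {w. yields P [Inl S] w}"
  by (simp add: grammar_lang_def yields_iff_derives)

lemma grammar_lang_start:
  "w \<in> grammar_lang P S \<longleftrightarrow> (\<exists>v. (S, v) \<in> P \<and> yields P v w)"
  by (auto simp: grammar_lang_yields yields_Inl)

section \<open>Renaming of nonterminals and finite unions\<close>

text \<open>\<open>Q\<close> may have further rules, but those with a left-hand side in the range of
  \<open>f\<close> are exactly the renamed rules of \<open>P\<close>. A derivation from
  \<open>f S\<close> therefore never leaves the renamed copy.\<close>

lemma grammar_lang_embed:
  assumes "inj f"
    and rules: "\<And>N v. (f N, v) \<in> Q \<longleftrightarrow> (\<exists>u. (N, u) \<in> P \<and> v = map (map_sum f (\<lambda>t. t)) u)"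
  shows "grammar_lang Q (f S) = grammar_lang P S"
proof -
  let ?f = "map (map_sum f (\<lambda>t. t))"
  have fwd: "yields Q (?f u) w" if "yields P u w" for u w
    using that
  proof induction
    case (Nonterm N v w1 u w2)
    then have "(f N, ?f v) \<in> Q" using rules by blast
    from yields.Nonterm[OF this Nonterm.IH] show ?case by simp
  qed (auto intro: yields.intros)
  have bwd: "yields P u w" if "yields Q v w" "v = ?f u" for u v w
    using that
  proof (induction arbitrary: u)
    case (Term v w t)
    then obtain u' where "u = Inr t # u'" "v = ?f u'"
      by (cases u; cases "hd u") auto
    then show ?case using Term by (auto intro: yields.intros)
  next
    case (Nonterm M x w1 v w2)
    then obtain N u' where u: "u = Inl N # u'" "v = ?f u'" "M = f N"
      by (cases u; cases "hd u") auto
    with Nonterm(1) obtain y where "(N, y) \<in> P" "x = ?f y" by (auto simp: rules)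
    then show ?case using Nonterm u by (auto intro: yields.intros)
  qed simp
  show ?thesis
    using fwd[of "[Inl S]"] bwd[of _ _ "[Inl S]"] by (auto simp: grammar_lang_yields)
qed

text \<open>Frees later constructions from \<open>nat\<close>: options and triples can serve as
  nonterminals.\<close>

lemma context_free_grammar_lang:
  fixes P :: "('n::countable, 't) production set"
  assumes "finite P"
  shows "context_free (grammar_lang P S)"
proof -
  define f where "f = (to_nat :: 'n \<Rightarrow> nat)"
  have f: "inj f" by (simp add: f_def)
  let ?Q = "(\<lambda>(N, u). (f N, map (map_sum f (\<lambda>t. t)) u)) ` P"
  have "grammar_lang ?Q (f S) = grammar_lang P S"
    by (rule grammar_lang_embed) (use f in \<open>auto dest: injD intro: rev_image_eqI\<close>)
  then show ?thesis
    using assms unfolding context_free_def by (metis finite_imageI)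
qed

text \<open>The grammars are placed side by side, with the index as a tag to keep them disjoint, and
  the fresh start symbol \<open>None\<close> chooses one of them. With the contexts
  \<open>x i\<close> and \<open>y i\<close> built in, one construction covers both unions and added
  letters.\<close>

lemma context_free_UN_context:
  fixes I :: "'i::countable set" and L :: "'i \<Rightarrow> 't list set"
  assumes "finite I" and cf: "\<And>i. i \<in> I \<Longrightarrow> context_free (L i)"
  shows "context_free (\<Union>i\<in>I. (\<lambda>w. x i @ w @ y i) ` L i)"
proof -
  from cf have "\<forall>i\<in>I. \<exists>(P :: (nat, 't) production set) S. finite P \<and> L i = grammar_lang P S"
    by (simp add: context_free_def)
  then obtain P :: "'i \<Rightarrow> (nat, 't) production set" and S
    where P: "\<And>i. i \<in> I \<Longrightarrow> finite (P i)" "\<And>i. i \<in> I \<Longrightarrow> L i = grammar_lang (P i) (S i)"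
    by metis
  define f where "f i N = Some (i, N)" for i :: 'i and N :: nat
  define R :: "'i \<Rightarrow> (('i \<times> nat) option, 't) production" where
    "R i = (None, map Inr (x i) @ Inl (f i (S i)) # map Inr (y i))"
    for i
  define Q where "Q = R ` I \<union> (\<Union>i\<in>I. (\<lambda>(N, u). (f i N, map (map_sum (f i) (\<lambda>t. t)) u)) ` P i)"
  have sub: "grammar_lang Q (f i (S i)) = L i" if "i \<in> I" for i
  proof -
    have "(f i N, v) \<in> Q \<longleftrightarrow> (\<exists>u. (N, u) \<in> P i \<and> v = map (map_sum (f i) (\<lambda>t. t)) u)" for N v
    proof
      show "\<exists>u. (N, u) \<in> P i \<and> v = map (map_sum (f i) (\<lambda>t. t)) u" if "(f i N, v) \<in> Q"
        using that by (auto simp: Q_def R_def f_def)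
      show "(f i N, v) \<in> Q" if "\<exists>u. (N, u) \<in> P i \<and> v = map (map_sum (f i) (\<lambda>t. t)) u"
      proof -
        from that obtain u where u: "(N, u) \<in> P i" "v = map (map_sum (f i) (\<lambda>t. t)) u"
          by blast
        have "(f i N, v) \<in> (\<lambda>(N, u). (f i N, map (map_sum (f i) (\<lambda>t. t)) u)) ` P i"
          by (rule image_eqI[OF _ u(1)]) (simp add: u(2))
        then show ?thesis using \<open>i \<in> I\<close> unfolding Q_def by blast
      qed
    qed
    moreover have "inj (f i)" by (simp add: f_def inj_on_def)
    ultimately show ?thesis
      unfolding P(2)[OF that] by (intro grammar_lang_embed)
  qed
  have start: "(None, v) \<in> Q \<longleftrightarrow> (\<exists>i\<in>I. v = snd (R i))" for v
    by (auto simp: Q_def R_def f_def)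
  have R: "yields Q (snd (R i)) w \<longleftrightarrow> w \<in> (\<lambda>w. x i @ w @ y i) ` L i" if "i \<in> I" for i w
    using sub[OF that, symmetric] unfolding grammar_lang_yields R_def
    by (auto simp: yields_append[of _ "map Inr _"] yields_append[of _ "[_]" "map Inr _", simplified]
        yields_map_Inr)
  have "grammar_lang Q None = (\<Union>i\<in>I. (\<lambda>w. x i @ w @ y i) ` L i)"
  proof (rule Set.set_eqI)
    fix w
    have "w \<in> grammar_lang Q None \<longleftrightarrow> (\<exists>i\<in>I. yields Q (snd (R i)) w)"
      unfolding grammar_lang_start start by blast
    then show "w \<in> grammar_lang Q None \<longleftrightarrow> w \<in> (\<Union>i\<in>I. (\<lambda>w. x i @ w @ y i) ` L i)"
      using R by simp
  qed
  moreover have "finite Q" using assms(1) P(1) by (auto simp: Q_def)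
  ultimately show ?thesis using context_free_grammar_lang by metis
qed

lemma context_free_context:
  assumes "context_free L"
  shows "context_free ((\<lambda>w. x @ w @ y) ` L)"
  using context_free_UN_context[of "{()}" "\<lambda>_. L" "\<lambda>_. x" "\<lambda>_. y"] assms by simp

section \<open>Finite-state transductions\<close>

text \<open>Only the output is computed; the state reached is
  \<open>foldl \<delta> p w\<close>.\<close>

fun transduce :: "('q \<Rightarrow> 't \<Rightarrow> 'q) \<Rightarrow> ('q \<Rightarrow> 't \<Rightarrow> 's) \<Rightarrow> 'q \<Rightarrow> 't list \<Rightarrow> 's list" where
  "transduce \<delta> out p [] = []"
| "transduce \<delta> out p (t # w) = out p t # transduce \<delta> out (\<delta> p t) w"

lemma transduce_append:
  "transduce \<delta> out p (u @ v) = transduce \<delta> out p u @ transduce \<delta> out (foldl \<delta> p u) v"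
  by (induction u arbitrary: p) auto

text \<open>The nonterminal \<open>(p, N, q)\<close> generates the outputs of those runs from \<open>p\<close> to \<open>q\<close>
  whose input is generated by \<open>N\<close>; a run through a sentential form guesses the state reached
  after each nonterminal.\<close>

fun runs :: "'q set \<Rightarrow> ('q \<Rightarrow> 't \<Rightarrow> 'q) \<Rightarrow> ('q \<Rightarrow> 't \<Rightarrow> 's) \<Rightarrow> 'q \<Rightarrow> ('n + 't) list \<Rightarrow> 'q \<Rightarrow>
    ('q \<times> 'n \<times> 'q + 's) list set" where
  "runs Q \<delta> out p [] q = (if p = q then {[]} else {})"
| "runs Q \<delta> out p (Inr t # u) q = (#) (Inr (out p t)) ` runs Q \<delta> out (\<delta> p t) u q"
| "runs Q \<delta> out p (Inl N # u) q = (\<Union>r\<in>Q. (#) (Inl (p, N, r)) ` runs Q \<delta> out r u q)"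

lemma finite_runs: "finite Q \<Longrightarrow> finite (runs Q \<delta> out p u q)"
  by (induction Q \<delta> out p u q rule: runs.induct) auto

lemma context_free_transduce:
  fixes Q :: "'q::countable set" and L :: "'t list set"
  assumes "context_free L" and Q: "finite Q" "p \<in> Q" "q \<in> Q"
    and \<delta>: "\<And>p t. p \<in> Q \<Longrightarrow> \<delta> p t \<in> Q"
  shows "context_free (transduce \<delta> out p ` {w \<in> L. foldl \<delta> p w = q})"
proof -
  from assms(1) obtain P :: "(nat, 't) production set" and S
    where P: "finite P" "L = grammar_lang P S" by (auto simp: context_free_def)
  \<comment> \<open>Restricting \<open>N\<close> to \<open>Domain P\<close> loses no rule and keeps
    \<open>R\<close> finite.\<close>
  define R where "R = (SIGMA (p, N, q) : Q \<times> Domain P \<times> Q. \<Union>u\<in>P `` {N}. runs Q \<delta> out p u q)"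
  have R: "((p, N, q), v) \<in> R \<longleftrightarrow> p \<in> Q \<and> q \<in> Q \<and> (\<exists>u. (N, u) \<in> P \<and> v \<in> runs Q \<delta> out p u q)"
    for p N q v
    unfolding R_def by auto
  have foldl_Q: "foldl \<delta> p w \<in> Q" if "p \<in> Q" for p w
    using that by (induction w arbitrary: p) (auto simp: \<delta>)
  \<comment> \<open>The guessed states are read off the actual run on \<open>w\<close>.\<close>
  have fwd: "\<exists>v \<in> runs Q \<delta> out p u (foldl \<delta> p w). yields R v (transduce \<delta> out p w)"
    if "yields P u w" "p \<in> Q" for u w p
    using that
  proof (induction arbitrary: p)
    case Nil
    then show ?case by simp
  next
    case (Term u w t)
    from Term.IH[OF \<delta>[OF Term.prems]] show ?case by (auto intro: yields.Term)
  next
    case (Nonterm N v w1 u w2)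
    let ?r = "foldl \<delta> p w1"
    have r: "?r \<in> Q" using Nonterm.prems by (rule foldl_Q)
    from Nonterm.IH(1)[OF Nonterm.prems] Nonterm.IH(2)[OF r] obtain v' u'
      where v': "v' \<in> runs Q \<delta> out p v ?r" "yields R v' (transduce \<delta> out p w1)"
        and u': "u' \<in> runs Q \<delta> out ?r u (foldl \<delta> ?r w2)" "yields R u' (transduce \<delta> out ?r w2)"
      by blast
    have "((p, N, ?r), v') \<in> R" using R r v' Nonterm by blast
    then have "yields R (Inl (p, N, ?r) # u') (transduce \<delta> out p (w1 @ w2))"
      unfolding transduce_append using v'(2) u'(2) by (rule yields.Nonterm)
    moreover have "Inl (p, N, ?r) # u' \<in> runs Q \<delta> out p (Inl N # u) (foldl \<delta> p (w1 @ w2))"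
      using r u'(1) by (simp, intro bexI[of _ ?r] imageI)
    ultimately show ?case by (rule bexI)
  qed
  \<comment> \<open>The triples force the guesses to be consistent: a tree below
    \<open>(p, N, r)\<close> gives an input word that really leads from \<open>p\<close> to
    \<open>r\<close>, so the pieces concatenate to one run.\<close>
  have bwd: "\<exists>w. yields P u w \<and> w' = transduce \<delta> out p w \<and> foldl \<delta> p w = q"
    if "yields R v w'" "v \<in> runs Q \<delta> out p u q" for v w' p u q
    using that
  proof (induction arbitrary: p u q)
    case Nil
    then have "u = []" "p = q"
      by (cases u; cases "hd u"; auto split: if_splits)+
    then show ?case by (intro exI[of _ "[]"]) simp
  next
    case (Term v w' t')
    then obtain t u' where u: "u = Inr t # u'" "t' = out p t" "v \<in> runs Q \<delta> out (\<delta> p t) u' q"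
      by (cases u; cases "hd u"; auto split: if_splits)
    from Term.IH[OF u(3)] obtain w where
      "yields P u' w" "w' = transduce \<delta> out (\<delta> p t) w" "foldl \<delta> (\<delta> p t) w = q" by blast
    then show ?case using u by (intro exI[of _ "t # w"]) (auto intro: yields.Term)
  next
    case (Nonterm M x w1' v w2')
    then obtain N r u' where u: "u = Inl N # u'" "M = (p, N, r)" "v \<in> runs Q \<delta> out r u' q"
      by (cases u; cases "hd u"; auto split: if_splits)
    from Nonterm.hyps(1) obtain y where y: "(N, y) \<in> P" "x \<in> runs Q \<delta> out p y r"
      unfolding u(2) R by blast
    from Nonterm.IH(1)[OF y(2)] Nonterm.IH(2)[OF u(3)] obtain w1 w2 where
      "yields P y w1" "w1' = transduce \<delta> out p w1" "foldl \<delta> p w1 = r"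
      "yields P u' w2" "w2' = transduce \<delta> out r w2" "foldl \<delta> r w2 = q"
      by blast
    then show ?case using u y
      by (intro exI[of _ "w1 @ w2"]) (auto simp: transduce_append intro: yields.Nonterm)
  qed
  have "grammar_lang R (p, S, q) = transduce \<delta> out p ` {w \<in> L. foldl \<delta> p w = q}"
  proof (intro equalityI subsetI)
    fix w' assume "w' \<in> grammar_lang R (p, S, q)"
    then have "yields R [Inl (p, S, q)] w'" by (simp add: grammar_lang_yields)
    moreover have "[Inl (p, S, q)] \<in> runs Q \<delta> out p [Inl S] q"
      using Q(3) by (auto intro!: bexI[of _ q])
    ultimately have "\<exists>w. yields P [Inl S] w \<and> w' = transduce \<delta> out p w \<and> foldl \<delta> p w = q"
      by (rule bwd)
    then show "w' \<in> transduce \<delta> out p ` {w \<in> L. foldl \<delta> p w = q}"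
      by (auto simp: P(2) grammar_lang_yields)
  next
    fix w' assume "w' \<in> transduce \<delta> out p ` {w \<in> L. foldl \<delta> p w = q}"
    then obtain w where "yields P [Inl S] w" "foldl \<delta> p w = q" "w' = transduce \<delta> out p w"
      by (auto simp: P(2) grammar_lang_yields)
    then show "w' \<in> grammar_lang R (p, S, q)"
      using fwd[of "[Inl S]" w p] Q(2) by (auto simp: grammar_lang_yields split: if_splits)
  qed
  moreover have "finite R" using Q(1) P(1)
    by (auto simp: R_def finite_runs finite_Domain finite_Image intro!: finite_SigmaI)
  ultimately show ?thesis using context_free_grammar_lang by metis
qed

section \<open>Coset transversals\<close>

text \<open>The indices become transducer states and hence components of nonterminals, which is why
  their type is countable.\<close>

locale coset_transversal = group G for G (structure) +
  fixes H :: "'a set" and I :: "'i::countable set" and b :: "'i \<Rightarrow> 'a"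
  assumes subgroup: "subgroup H G"
    and finite_index: "finite I"
    and b_closed: "i \<in> I \<Longrightarrow> b i \<in> carrier G"
    and disjoint: "disjoint_family_on (\<lambda>i. H #> b i) I"
    and cover: "carrier G = (\<Union>i\<in>I. H #> b i)"
begin

abbreviation GH where "GH \<equiv> G\<lparr>carrier := H\<rparr>"

lemma H_subset: "H \<subseteq> carrier G"
  by (rule subgroup.subset[OF subgroup])

lemma group_H: "group GH"
  by (rule subgroup.subgroup_is_group[OF subgroup is_group])

text \<open>Inverses of elements of \<open>H\<close> agree in both groups, so words over
  \<open>H\<close> can be evaluated in \<open>G\<close>.\<close>

lemma word_val_H:
  assumes "B \<subseteq> H" "w \<in> lists (letters B)"
  shows "word_val GH w = word_val G w" "word_val G w \<in> H"
proof -
  show "word_val GH w = word_val G w"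
    using assms(2)
  proof (induction w)
    case (Cons x w)
    then have "letter_val GH x = letter_val G x"
      using assms(1) m_inv_consistent[OF subgroup] by (auto simp: letters_def)
    then show ?case using Cons by (simp add: word_val_def)
  qed (simp add: word_val_def)
  then show "word_val G w \<in> H"
    using group.word_val_closed[OF group_H, of B w] assms by simp
qed

lemma mem_coset_iff:
  assumes "i \<in> I" "g \<in> carrier G"
  shows "g \<in> H #> b i \<longleftrightarrow> g \<otimes> inv b i \<in> H"
  using subgroup.rcos_module[OF subgroup is_group b_closed[OF assms(1)] assms(2)] .

definition coset_index :: "'a \<Rightarrow> 'i" where
  "coset_index g = (SOME i. i \<in> I \<and> g \<in> H #> b i)"

lemma coset_index:
  assumes "g \<in> carrier G"
  shows "coset_index g \<in> I" "g \<in> H #> b (coset_index g)"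
proof -
  from assms have "\<exists>i. i \<in> I \<and> g \<in> H #> b i" unfolding cover by blast
  from someI_ex[OF this] show "coset_index g \<in> I" "g \<in> H #> b (coset_index g)"
    by (simp_all add: coset_index_def)
qed

lemma coset_index_eq:
  assumes "i \<in> I" "g \<in> H #> b i"
  shows "coset_index g = i"
proof (rule ccontr)
  assume ne: "coset_index g \<noteq> i"
  have "g \<in> carrier G" using assms unfolding cover by blast
  with disjoint_family_onD[OF disjoint coset_index(1) assms(1) ne] coset_index(2) assms(2)
  show False by blast
qed

definition base :: 'i where
  "base = coset_index \<one>"

lemma base: "base \<in> I" "b base \<in> H"
proof -
  show "base \<in> I" by (simp add: base_def coset_index)
  have "inv b base \<in> H"
    using coset_index(2)[of \<one>] mem_coset_iff[OF \<open>base \<in> I\<close>, of \<one>] b_closed[OF \<open>base \<in> I\<close>]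
    by (simp add: base_def)
  then show "b base \<in> H"
    using subgroup.m_inv_closed[OF subgroup] b_closed[OF \<open>base \<in> I\<close>] by fastforce
qed

section \<open>Schreier rewriting\<close>

text \<open>The default \<open>p\<close> keeps the state in \<open>I\<close> for every letter of the
  type, as \<open>context_free_transduce\<close> demands.\<close>

definition step :: "'a set \<Rightarrow> 'i \<Rightarrow> 'a letter \<Rightarrow> 'i" where
  "step A p x = (if x \<in> letters A then coset_index (b p \<otimes> letter_val G x) else p)"

definition schreier :: "'a set \<Rightarrow> 'i \<Rightarrow> 'a letter \<Rightarrow> 'a" where
  "schreier A p x = b p \<otimes> letter_val G x \<otimes> inv b (step A p x)"

text \<open>All output letters are positive: \<open>Neg a\<close> has Schreier generators of its
  own, because \<open>schreier_gens\<close> ranges over \<open>letters A\<close>.\<close>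

abbreviation rewrite :: "'a set \<Rightarrow> 'i \<Rightarrow> 'a letter list \<Rightarrow> 'a letter list" where
  "rewrite A \<equiv> transduce (step A) (\<lambda>p x. Pos (schreier A p x))"

text \<open>The representative of the coset \<open>H\<close> itself need not be \<open>\<one>\<close>; it is added to the usual
  Schreier generators.\<close>

definition schreier_gens :: "'a set \<Rightarrow> 'a set" where
  "schreier_gens A = insert (b base) (case_prod (schreier A) ` (I \<times> letters A))"

context
  fixes A assumes A: "A \<subseteq> carrier G"
begin

lemma step_closed: "p \<in> I \<Longrightarrow> step A p x \<in> I"
  using letter_val_closed[OF A] b_closed by (simp add: step_def coset_index)

lemma schreier_in_H:
  assumes "p \<in> I" "x \<in> letters A"
  shows "schreier A p x \<in> H"
proof -
  have "b p \<otimes> letter_val G x \<in> carrier G"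
    using assms letter_val_closed[OF A] b_closed by blast
  from coset_index[OF this] mem_coset_iff[OF _ this] show ?thesis
    using assms by (simp add: schreier_def step_def)
qed

lemma schreier_gens_subset: "schreier_gens A \<subseteq> H"
  using base schreier_in_H by (auto simp: schreier_gens_def)

lemma rewrite:
  assumes "p \<in> I" "w \<in> lists (letters A)"
  shows "foldl (step A) p w \<in> I"
    and "rewrite A p w \<in> lists (letters (schreier_gens A))"
    and "word_val G (rewrite A p w) = b p \<otimes> word_val G w \<otimes> inv b (foldl (step A) p w)"
proof -
  have "foldl (step A) p w \<in> I \<and> rewrite A p w \<in> lists (letters (schreier_gens A)) \<and>
      word_val G (rewrite A p w) = b p \<otimes> word_val G w \<otimes> inv b (foldl (step A) p w)"
    using assms
  proof (induction w arbitrary: p)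
    case Nil
    then show ?case using b_closed by simp
  next
    case (Cons x w)
    let ?q = "step A p x"
    let ?r = "foldl (step A) ?q w"
    have q: "?q \<in> I" using Cons.prems by (simp add: step_closed)
    note IH = Cons.IH[OF q]
    have x: "letter_val G x \<in> carrier G" and w: "word_val G w \<in> carrier G"
      using Cons.prems letter_val_closed[OF A] word_val_closed[OF A] by auto
    have r: "?r \<in> I" using IH Cons.prems by simp
    note c = x w b_closed[OF Cons.prems(1)] b_closed[OF q] b_closed[OF r]
    \<comment> \<open>The inverse that closes the first Schreier generator meets the representative
      \<open>b ?q\<close> that opens the value of the remaining word.\<close>
    have "word_val G (rewrite A p (x # w)) =
        (b p \<otimes> letter_val G x \<otimes> inv b ?q) \<otimes> (b ?q \<otimes> word_val G w \<otimes> inv b ?r)"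
      using IH Cons.prems by (simp add: schreier_def)
    also have "\<dots> = b p \<otimes> letter_val G x \<otimes> (inv b ?q \<otimes> b ?q) \<otimes> (word_val G w \<otimes> inv b ?r)"
      using c by (simp only: m_assoc m_closed inv_closed)
    also have "\<dots> = b p \<otimes> (letter_val G x \<otimes> word_val G w) \<otimes> inv b ?r"
      using c by (simp add: m_assoc)
    finally have "word_val G (rewrite A p (x # w)) =
        b p \<otimes> word_val G (x # w) \<otimes> inv b (foldl (step A) p (x # w))"
      by simp
    moreover have "schreier A p x \<in> schreier_gens A"
      using Cons.prems by (auto simp: schreier_gens_def)
    ultimately show ?case using IH Cons.prems by (auto simp: letters_def)
  qed
  then show "foldl (step A) p w \<in> I"
    and "rewrite A p w \<in> lists (letters (schreier_gens A))"
    and "word_val G (rewrite A p w) = b p \<otimes> word_val G w \<otimes> inv b (foldl (step A) p w)"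
    by blast+
qed

text \<open>Telescoping from \<open>base\<close> leaves a leading factor \<open>b base\<close>,
  which the prefixed \<open>Neg (b base)\<close> cancels. The resulting value lies in
  \<open>H\<close>, and this identifies the final state with the coset of the original word.\<close>

lemma rewrite_base:
  assumes "w \<in> lists (letters A)"
  defines "v \<equiv> Neg (b base) # rewrite A base w" and "i \<equiv> foldl (step A) base w"
  shows "v \<in> lists (letters (schreier_gens A))"
    and "word_val G v = word_val G w \<otimes> inv b i"
    and "coset_index (word_val G w) = i"
proof -
  note r = rewrite[OF base(1) assms(1), folded i_def]
  show v: "v \<in> lists (letters (schreier_gens A))"
    using r(2) by (auto simp: v_def letters_def schreier_gens_def)
  have c: "word_val G w \<in> carrier G" "b base \<in> carrier G" "b i \<in> carrier G"
    using word_val_closed[OF A assms(1)] b_closed base r(1) by auto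
  show eq: "word_val G v = word_val G w \<otimes> inv b i"
    using c r(3) by (simp add: v_def m_assoc[symmetric])
  have "word_val G v \<in> H" using word_val_H(2)[OF schreier_gens_subset v] .
  then show "coset_index (word_val G w) = i"
    using coset_index_eq[OF r(1)] mem_coset_iff[OF r(1) c(1)] eq by simp
qed

end

lemma finite_generating_set_schreier:
  assumes "finite_generating_set G A"
  shows "finite_generating_set GH (schreier_gens A)"
proof -
  have A: "finite A" "A \<subseteq> carrier G" "generate G A = carrier G"
    using assms by (auto simp: finite_generating_set_def)
  let ?B = "schreier_gens A"
  have B: "?B \<subseteq> H" using A(2) by (rule schreier_gens_subset)
  have fin: "finite ?B"
    using A(1) finite_index by (simp add: schreier_gens_def letters_def)
  have val: "word_val G w \<in> generate G ?B" if "w \<in> lists (letters ?B)" for w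
    using that
  proof (induction w)
    case (Cons x w)
    then have "letter_val G x \<in> generate G ?B"
      by (auto simp: letters_def intro: generate.intros)
    then show ?case using Cons by (auto intro: generate.eng)
  qed (simp add: generate.one)
  have "H \<subseteq> generate G ?B"
  proof
    fix h assume h: "h \<in> H"
    then have hc: "h \<in> carrier G" using H_subset by blast
    then obtain w where w: "w \<in> lists (letters A)" "word_val G w = h"
      using generate_imp_word_val[OF A(2)] A(3) by blast
    \<comment> \<open>Since \<open>b base\<close> lies in \<open>H\<close>, so does this product;
      hence \<open>h\<close> belongs to the coset of \<open>b base\<close>, and every word for
      \<open>h\<close> ends in state \<open>base\<close>.\<close>
    have "h \<otimes> inv b base \<in> H"
      using h base subgroup.m_closed[OF subgroup] subgroup.m_inv_closed[OF subgroup] by blast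
    then have "coset_index h = base"
      using base hc by (intro coset_index_eq) (simp_all add: mem_coset_iff)
    with rewrite_base[OF A(2) w(1)] w(2) have "h \<otimes> inv b base \<in> generate G ?B"
      using val by metis
    moreover have "b base \<in> generate G ?B"
      by (simp add: generate.incl schreier_gens_def)
    ultimately have "h \<otimes> inv b base \<otimes> b base \<in> generate G ?B"
      by (rule generate.eng)
    then show "h \<in> generate G ?B"
      using hc base b_closed by (simp add: m_assoc)
  qed
  \<comment> \<open>Generation inside \<open>GH\<close> agrees with generation inside
    \<open>G\<close>, where the argument took place.\<close>
  then have "generate GH ?B = H"
    using generate_consistent[OF B subgroup] generate_subgroup_incl[OF B subgroup] by auto
  then show ?thesis using fin B by (simp add: finite_generating_set_def)
qed

section \<open>The two inclusions\<close>

lemma Alg_decompose: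
  assumes "K \<in> Alg G"
  shows "\<exists>L. K = (\<Union>i\<in>I. L i #> b i) \<and> (\<forall>i\<in>I. L i \<in> Alg GH)"
proof -
  from assms obtain A M where gen: "finite_generating_set G A"
    and M: "context_free M" "M \<subseteq> lists (letters A)" "word_val G ` M = K"
    by (auto simp: Alg_def algebraic_wrt_def)
  have A: "A \<subseteq> carrier G" using gen by (simp add: finite_generating_set_def)
  note B = schreier_gens_subset[OF A]
  note genB = finite_generating_set_schreier[OF gen]
  \<comment> \<open>The words are sorted by final state, that is, by the coset of their
    value.\<close>
  define W where "W i = {w \<in> M. foldl (step A) base w = i}" for i
  \<comment> \<open>The trailing \<open>[]\<close> gives the shape of
    \<open>context_free_context\<close>.\<close>
  define v where "v w = [Neg (b base)] @ rewrite A base w @ []" for w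
  define L where "L i = word_val GH ` v ` W i" for i
  have W: "v w \<in> lists (letters (schreier_gens A))"
      "word_val GH (v w) = word_val G w \<otimes> inv b i" "word_val G w \<in> carrier G"
    if "w \<in> W i" for w i
  proof -
    have w: "w \<in> lists (letters A)" "foldl (step A) base w = i"
      using that M(2) by (auto simp: W_def)
    show "v w \<in> lists (letters (schreier_gens A))"
      using rewrite_base(1)[OF A w(1)] by (simp add: v_def)
    then show "word_val GH (v w) = word_val G w \<otimes> inv b i"
      using rewrite_base(2)[OF A w(1)] w(2) word_val_H(1)[OF B] by (simp add: v_def)
    show "word_val G w \<in> carrier G" using word_val_closed[OF A w(1)] .
  qed
  have "L i \<in> Alg GH" if "i \<in> I" for i
  proof -
    have "context_free (rewrite A base ` W i)"
      unfolding W_def using M(1) finite_index base(1) that step_closed[OF A]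
      by (rule context_free_transduce)
    from context_free_context[OF this, of "[Neg (b base)]" "[]"]
    have "context_free (v ` W i)" by (simp add: v_def image_image)
    moreover have "v ` W i \<subseteq> lists (letters (schreier_gens A))" using W(1) by blast
    ultimately show ?thesis
      using genB unfolding Alg_def algebraic_wrt_def L_def by blast
  qed
  moreover have "L i #> b i = word_val G ` W i" if "i \<in> I" for i
  proof -
    have "L i #> b i = (\<lambda>w. word_val GH (v w) \<otimes> b i) ` W i"
      by (auto simp: L_def r_coset_def)
    also have "\<dots> = word_val G ` W i"
      using W(2,3) b_closed[OF that] by (intro image_cong) (simp_all add: m_assoc)
    finally show ?thesis .
  qed
  \<comment> \<open>Runs from \<open>base\<close> on words over \<open>A\<close> stay in
    \<open>I\<close>, so no word is lost.\<close>
  moreover have "M = (\<Union>i\<in>I. W i)"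
    using rewrite(1)[OF A base(1)] M(2) by (auto simp: W_def)
  ultimately show ?thesis using M(3) by (intro exI[of _ L]) (simp add: image_UN)
qed

lemma Alg_compose:
  assumes "finitely_generated G" and L: "\<And>i. i \<in> I \<Longrightarrow> L i \<in> Alg GH"
  shows "(\<Union>i\<in>I. L i #> b i) \<in> Alg G"
proof -
  from assms(1) obtain A where gen: "finite_generating_set G A"
    by (auto simp: finitely_generated_def)
  then have A: "finite A" "A \<subseteq> carrier G" "generate G A = carrier G"
    by (auto simp: finite_generating_set_def)
  let ?B = "schreier_gens A"
  \<comment> \<open>Enlarged so that words over \<open>?B\<close> are words over \<open>?C\<close>
    and each \<open>b i\<close> is a single letter.\<close>
  let ?C = "A \<union> ?B \<union> b ` I"
  have B: "?B \<subseteq> H" using A(2) by (rule schreier_gens_subset)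
  have genB: "finite_generating_set GH ?B" using gen by (rule finite_generating_set_schreier)
  have C: "?C \<subseteq> carrier G" using A(2) B H_subset b_closed by blast
  have "carrier G \<subseteq> generate G ?C" using mono_generate[of A ?C] A(3) by blast
  then have genC: "finite_generating_set G ?C"
    using A(1) genB finite_index C generate_incl[OF C]
    by (auto simp: finite_generating_set_def)
  \<comment> \<open>Independence of the generating set allows the same \<open>?B\<close> for all
    \<open>L i\<close>.\<close>
  have "\<forall>i\<in>I. \<exists>M. context_free M \<and> M \<subseteq> lists (letters ?B) \<and> word_val GH ` M = L i"
    using L group.Alg_iff_algebraic_wrt[OF group_H genB] by (auto simp: algebraic_wrt_def)
  then obtain M where M: "\<And>i. i \<in> I \<Longrightarrow> context_free (M i)"
      "\<And>i. i \<in> I \<Longrightarrow> M i \<subseteq> lists (letters ?B)" "\<And>i. i \<in> I \<Longrightarrow> word_val GH ` M i = L i"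
    by metis
  let ?M = "\<Union>i\<in>I. (\<lambda>w. [] @ w @ [Pos (b i)]) ` M i"
  have "context_free ?M" using finite_index M(1) by (rule context_free_UN_context)
  moreover have lists: "w \<in> lists (letters ?C)" if "w \<in> lists (letters ?B)" for w
    using that by (auto simp: letters_def)
  have "?M \<subseteq> lists (letters ?C)"
    using M(2) lists by (fastforce simp: letters_def)
  moreover have "word_val G ` ?M = (\<Union>i\<in>I. L i #> b i)"
  proof -
    have "word_val G (w @ [Pos (b i)]) = word_val GH w \<otimes> b i" if "i \<in> I" "w \<in> M i" for i w
    proof -
      have w: "w \<in> lists (letters ?B)" using M(2) that by blast
      have "[Pos (b i)] \<in> lists (letters ?C)" using that by (simp add: letters_def)
      from word_val_append[OF C lists[OF w] this] show ?thesis
        using b_closed[OF that(1)] word_val_H(1)[OF B w] by simp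
    qed
    then have "word_val G ` (\<lambda>w. [] @ w @ [Pos (b i)]) ` M i = L i #> b i" if "i \<in> I" for i
      using that by (auto simp: M(3)[symmetric] r_coset_def image_iff)
    then show ?thesis by (simp add: image_UN)
  qed
  ultimately show ?thesis
    using genC unfolding Alg_def algebraic_wrt_def by blast
qed

end

theorem proposition3p7:
  fixes G :: "('a, 'b) monoid_scheme" and H :: "'a set"
    and n :: nat and b :: "nat \<Rightarrow> 'a"
  assumes "group G"
    and "finitely_generated G"
    and "subgroup H G"
    and "finite (rcosets\<^bsub>G\<^esub> H)"
    and "\<And>i. i \<in> {1..n} \<Longrightarrow> b i \<in> carrier G"
    and "disjoint_family_on (\<lambda>i. H #>\<^bsub>G\<^esub> b i) {1..n}"
    and "carrier G = (\<Union>i\<in>{1..n}. H #>\<^bsub>G\<^esub> b i)"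
  shows "Alg G = {\<Union>i\<in>{1..n}. L i #>\<^bsub>G\<^esub> b i | L.
                    \<forall>i\<in>{1..n}. L i \<in> Alg (G\<lparr>carrier := H\<rparr>)}"
proof -
  interpret coset_transversal G H "{1..n}" b
    using assms by (intro coset_transversal.intro coset_transversal_axioms.intro) simp_all
  show ?thesis
    using Alg_decompose Alg_compose[OF assms(2)] by blast
qed

end
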